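(* Let $H$ be a complex Hilbert space and $\mathcal{L}$ a skew-adjoint operator on $H$ (the generator of a strongly continuous unitary group $\{\mathcal{U}(t)\}_{t\in\mathbb{R}}$). Let $z\in D(\mathcal{L})$ with $z\neq0$, $\mathcal{P}:=(\cdot,z)(z,z)^{-1}z$, $\mathcal{Q}:=1-\mathcal{P}$. Then $\overline{\mathcal{QL}}\mathcal{Q}$ generates a strongly continuous unitary group $\{\mathcal{G}(t)\}_{t\in\mathbb{R}}$.
   Context: The scalar product $(\cdot,\cdot)$ on $H$ is conjugate-linear in its second argument. The overbar denotes the closure; $D(\overline{\mathcal{QL}}\mathcal{Q})=\{x:\mathcal{Q}x\in D(\overline{\mathcal{QL}})\}$. Skew-adjoint means $\mathcal{L}^\dagger=-\mathcal{L}$. *)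

theory Defs
  imports "HOL-Analysis.Analysis"
begin

text \<open>A complex Hilbert space is modelled on a type 'a with an explicit complex
scalar multiplication scl and an inner product ip, linear in the first and
conjugate-linear in the second argument. The norm and convergence are the ones
induced by ip. Unbounded linear operators are represented by their graphs.\<close>

definition hnorm :: "('a \<Rightarrow> 'a \<Rightarrow> complex) \<Rightarrow> 'a \<Rightarrow> real" where
  "hnorm ip x = sqrt (Re (ip x x))"

definition hconv :: "('a::ab_group_add \<Rightarrow> 'a \<Rightarrow> complex) \<Rightarrow> ('b \<Rightarrow> 'a) \<Rightarrow> 'a \<Rightarrow> 'b filter \<Rightarrow> bool" where
  "hconv ip f l F \<longleftrightarrow> ((\<lambda>t. hnorm ip (f t - l)) \<longlongrightarrow> 0) F"

definition hcauchy :: "('a::ab_group_add \<Rightarrow> 'a \<Rightarrow> complex) \<Rightarrow> (nat \<Rightarrow> 'a) \<Rightarrow> bool" where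
  "hcauchy ip X \<longleftrightarrow> (\<forall>e>0. \<exists>N. \<forall>m\<ge>N. \<forall>n\<ge>N. hnorm ip (X m - X n) < e)"

definition complex_hilbert_space ::
  "(complex \<Rightarrow> 'a::ab_group_add \<Rightarrow> 'a) \<Rightarrow> ('a \<Rightarrow> 'a \<Rightarrow> complex) \<Rightarrow> bool" where
  "complex_hilbert_space scl ip \<longleftrightarrow>
     vector_space scl \<and>
     (\<forall>x y w. ip (x + y) w = ip x w + ip y w) \<and>
     (\<forall>a x y. ip (scl a x) y = a * ip x y) \<and>
     (\<forall>x y. ip y x = cnj (ip x y)) \<and>
     (\<forall>x. 0 \<le> Re (ip x x)) \<and>
     (\<forall>x. ip x x = 0 \<longrightarrow> x = 0) \<and>
     (\<forall>X. hcauchy ip X \<longrightarrow> (\<exists>l. hconv ip X l sequentially))"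

definition op_dom :: "('a \<times> 'a) set \<Rightarrow> 'a set" where
  "op_dom G = fst ` G"

definition lin_op :: "(complex \<Rightarrow> 'a::ab_group_add \<Rightarrow> 'a) \<Rightarrow> ('a \<times> 'a) set \<Rightarrow> bool" where
  "lin_op scl G \<longleftrightarrow>
     (0, 0) \<in> G \<and>
     (\<forall>x v y w. (x, v) \<in> G \<longrightarrow> (y, w) \<in> G \<longrightarrow> (x + y, v + w) \<in> G) \<and>
     (\<forall>a x v. (x, v) \<in> G \<longrightarrow> (scl a x, scl a v) \<in> G) \<and>
     (\<forall>y. (0, y) \<in> G \<longrightarrow> y = 0)"

definition hdense :: "('a::ab_group_add \<Rightarrow> 'a \<Rightarrow> complex) \<Rightarrow> 'a set \<Rightarrow> bool" where
  "hdense ip S \<longleftrightarrow> (\<forall>x. \<forall>e>0. \<exists>s\<in>S. hnorm ip (x - s) < e)"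

definition adjoint_graph :: "('a \<Rightarrow> 'a \<Rightarrow> complex) \<Rightarrow> ('a \<times> 'a) set \<Rightarrow> ('a \<times> 'a) set" where
  "adjoint_graph ip G = {(y, w). \<forall>x v. (x, v) \<in> G \<longrightarrow> ip v y = ip x w}"

definition skew_adjoint ::
  "(complex \<Rightarrow> 'a::ab_group_add \<Rightarrow> 'a) \<Rightarrow> ('a \<Rightarrow> 'a \<Rightarrow> complex) \<Rightarrow> ('a \<times> 'a) set \<Rightarrow> bool" where
  "skew_adjoint scl ip G \<longleftrightarrow>
     lin_op scl G \<and> hdense ip (op_dom G) \<and>
     adjoint_graph ip G = {(x, - v) | x v. (x, v) \<in> G}"

definition graph_closure :: "('a::ab_group_add \<Rightarrow> 'a \<Rightarrow> complex) \<Rightarrow> ('a \<times> 'a) set \<Rightarrow> ('a \<times> 'a) set" where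
  "graph_closure ip G = {(x, y). \<exists>X Y. (\<forall>n. (X n, Y n) \<in> G) \<and>
       hconv ip X x sequentially \<and> hconv ip Y y sequentially}"

definition unitary ::
  "(complex \<Rightarrow> 'a::ab_group_add \<Rightarrow> 'a) \<Rightarrow> ('a \<Rightarrow> 'a \<Rightarrow> complex) \<Rightarrow> ('a \<Rightarrow> 'a) \<Rightarrow> bool" where
  "unitary scl ip U \<longleftrightarrow>
     (\<forall>x y. U (x + y) = U x + U y) \<and> (\<forall>a x. U (scl a x) = scl a (U x)) \<and>
     (\<forall>x y. ip (U x) (U y) = ip x y) \<and> surj U"

definition generator_graph ::
  "(complex \<Rightarrow> 'a::ab_group_add \<Rightarrow> 'a) \<Rightarrow> ('a \<Rightarrow> 'a \<Rightarrow> complex) \<Rightarrow> (real \<Rightarrow> 'a \<Rightarrow> 'a) \<Rightarrow> ('a \<times> 'a) set" where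
  "generator_graph scl ip G =
     {(x, y). hconv ip (\<lambda>h. scl (complex_of_real (1 / h)) (G h x - x)) y (at 0)}"

definition generates_sc_unitary_group ::
  "(complex \<Rightarrow> 'a::ab_group_add \<Rightarrow> 'a) \<Rightarrow> ('a \<Rightarrow> 'a \<Rightarrow> complex) \<Rightarrow> ('a \<times> 'a) set \<Rightarrow> bool" where
  "generates_sc_unitary_group scl ip A \<longleftrightarrow>
     (\<exists>G :: real \<Rightarrow> 'a \<Rightarrow> 'a.
        (\<forall>t. unitary scl ip (G t)) \<and> G 0 = id \<and>
        (\<forall>s t. G (s + t) = G s \<circ> G t) \<and>
        (\<forall>x. hconv ip (\<lambda>t. G t x) x (at 0)) \<and>
        generator_graph scl ip G = A)"

end

theory Submission
  imports Defs
begin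

text \<open>
  Since \<open>z\<close> lies in the domain of \<open>L\<close>, skewness gives \<open>P L y = - (y, L z) (z, z)\<^sup>-\<^sup>1 z\<close>,
  so \<open>Q L\<close> is a bounded perturbation of \<open>L\<close> and already closed, and the compression
  \<open>A = Q L Q\<close> is again skew-adjoint. It remains to prove Stone's theorem for \<open>A\<close>. Instead of
  exponentials of bounded approximations we use Cayley transforms
  \<open>C t = (1 + t/2 A) (1 - t/2 A)\<^sup>-\<^sup>1\<close>: they are unitary, commute with each other and with \<open>A\<close>, and
  on the domain of \<open>A\<^sup>2\<close> satisfy \<open>\<parallel>C (a + b) x - C a (C b x)\<parallel> \<le> (\<bar>a\<bar> + \<bar>b\<bar>)\<^sup>2 \<parallel>A\<^sup>2 x\<parallel>\<close>.
  Telescoping this defect shows that \<open>C (t / 2\<^sup>k)\<close> raised to the power \<open>2\<^sup>k\<close> converges strongly to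
  a unitary group \<open>U t\<close> whose generator extends \<open>A\<close>; as that generator is skew-symmetric and \<open>A\<close>
  is skew-adjoint, they coincide.
\<close>

section \<open>Iterates of commuting maps and dyadic limits\<close>

lemma funpow_comp_commute:
  assumes "f \<circ> g = g \<circ> f"
  shows "(f \<circ> g) ^^ n = f ^^ n \<circ> g ^^ n"
proof (induction n)
  case (Suc n)
  have "g ((f ^^ n) x) = (f ^^ n) (g x)" for x
    by (induction n) (use fun_cong [OF assms, symmetric] in simp_all)
  then show ?case using Suc by (simp add: fun_eq_iff)
qed simp

lemma power_half_tendsto_0: "(\<lambda>k. c / 2 ^ k) \<longlonglongrightarrow> (0 :: real)"
  by (intro tendsto_divide_0 [OF tendsto_const] filterlim_at_top_imp_at_infinity
      filterlim_realpow_sequentially_gt1) simp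

section \<open>Complex Hilbert spaces\<close>

locale hilbert =
  fixes scl :: "complex \<Rightarrow> 'a::ab_group_add \<Rightarrow> 'a"
    and ip :: "'a \<Rightarrow> 'a \<Rightarrow> complex"
  assumes hilbert: "complex_hilbert_space scl ip"
begin

sublocale vector_space scl
  using hilbert by (simp add: complex_hilbert_space_def)

abbreviation N :: "'a \<Rightarrow> real" where "N \<equiv> hnorm ip"

abbreviation rscl :: "real \<Rightarrow> 'a \<Rightarrow> 'a" where "rscl r \<equiv> scl (complex_of_real r)"

section \<open>Inner product algebra and the induced norm\<close>

lemma ip_add_left: "ip (x + y) w = ip x w + ip y w"
  and ip_scl_left: "ip (scl a x) y = a * ip x y"
  and ip_cnj: "ip y x = cnj (ip x y)"
  and Re_ip_nonneg: "0 \<le> Re (ip x x)"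
  and ip_eq_0D: "ip x x = 0 \<Longrightarrow> x = 0"
  and complete: "hcauchy ip X \<Longrightarrow> \<exists>l. hconv ip X l sequentially"
  using hilbert unfolding complex_hilbert_space_def by meson+

lemma ip_add_right: "ip w (x + y) = ip w x + ip w y"
  by (metis ip_cnj ip_add_left complex_cnj_add)

lemma ip_scl_right: "ip x (scl a y) = cnj a * ip x y"
  by (metis ip_cnj ip_scl_left complex_cnj_mult)

lemma ip_zero_left [simp]: "ip 0 x = 0"
  using ip_add_left [of 0 0 x] by simp

lemma ip_zero_right [simp]: "ip x 0 = 0"
  using ip_add_right [of x 0 0] by simp

lemma ip_minus_left: "ip (- x) y = - ip x y"
  using ip_add_left [of x "- x" y] by (simp add: eq_neg_iff_add_eq_0 add.commute)

lemma ip_minus_right: "ip x (- y) = - ip x y"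
  using ip_add_right [of x y "- y"] by (simp add: eq_neg_iff_add_eq_0 add.commute)

lemma ip_diff_left: "ip (x - y) w = ip x w - ip y w"
  using ip_add_left [of x "- y" w] by (simp add: ip_minus_left)

lemma ip_diff_right: "ip w (x - y) = ip w x - ip w y"
  using ip_add_right [of w x "- y"] by (simp add: ip_minus_right)

lemmas ip_simps = ip_add_left ip_add_right ip_diff_left ip_diff_right
  ip_minus_left ip_minus_right ip_scl_left ip_scl_right

lemma ip_self: "ip x x = complex_of_real ((N x)\<^sup>2)"
proof -
  have "Im (ip x x) = 0"
    using ip_cnj [of x x] by (metis cnj.sel(2) equal_neg_zero)
  then show ?thesis
    by (simp add: hnorm_def Re_ip_nonneg complex_eq_iff)
qed

lemma N_sq: "(N x)\<^sup>2 = Re (ip x x)"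
  by (simp add: ip_self)

lemma N_nonneg [simp]: "0 \<le> N x"
  by (simp add: hnorm_def Re_ip_nonneg)

lemma N_zero [simp]: "N 0 = 0"
  by (simp add: hnorm_def)

lemma N_eq_0: "N x = 0 \<longleftrightarrow> x = 0"
  using ip_self [of x] ip_eq_0D [of x] by auto

lemma N_scl: "N (scl a x) = cmod a * N x"
proof -
  have "(N (scl a x))\<^sup>2 = (cmod a * N x)\<^sup>2"
  proof -
    have "ip (scl a x) (scl a x) = complex_of_real ((cmod a)\<^sup>2 * (N x)\<^sup>2)"
      by (simp add: ip_scl_left ip_scl_right ip_self [of x] complex_norm_square mult_ac del: of_real_power)
    then show ?thesis
      by (simp add: N_sq power_mult_distrib del: of_real_power of_real_mult)
  qed
  then show ?thesis
    by simp
qed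

lemma N_minus: "N (- x) = N x"
  by (simp add: hnorm_def ip_simps)

lemma N_diff_commute: "N (x - y) = N (y - x)"
  using N_minus [of "x - y"] by simp

lemma N_add_sq: "(N (x + y))\<^sup>2 = (N x)\<^sup>2 + (N y)\<^sup>2 + 2 * Re (ip x y)"
  using ip_cnj [of y x] by (simp add: N_sq ip_simps)

lemma parallelogram: "(N (x + y))\<^sup>2 + (N (x - y))\<^sup>2 = 2 * (N x)\<^sup>2 + 2 * (N y)\<^sup>2"
  by (simp add: N_sq ip_simps)

lemma Cauchy_Schwarz: "cmod (ip x y) \<le> N x * N y"
proof (cases "y = 0")
  case False
  \<comment> \<open>\<open>scl a y\<close> is the orthogonal projection of \<open>x\<close> onto the
    line through \<open>y\<close>; the inequality is the nonnegativity of the squared distance from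
    \<open>x\<close> to it.\<close>
  define a where "a = ip x y / ip y y"
  have yy: "ip y y \<noteq> 0" using False ip_eq_0D by blast
  have "ip (x - scl a y) (x - scl a y) = ip x x - a * ip y x"
    using yy by (simp add: ip_simps a_def)
  also have "\<dots> = complex_of_real ((N x)\<^sup>2 - (cmod (ip x y))\<^sup>2 / (N y)\<^sup>2)"
    using ip_cnj [of y x]
    by (simp add: a_def ip_self complex_norm_square del: of_real_power)
  finally have "0 \<le> (N x)\<^sup>2 - (cmod (ip x y))\<^sup>2 / (N y)\<^sup>2"
    using Re_ip_nonneg [of "x - scl a y"] by (simp del: of_real_power of_real_diff of_real_divide)
  moreover have "N y > 0" using False N_eq_0 [of y] N_nonneg [of y] by linarith
  ultimately have "(cmod (ip x y))\<^sup>2 \<le> (N x * N y)\<^sup>2"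
    by (simp add: divide_simps power_mult_distrib)
  then show ?thesis
    by (rule power2_le_imp_le) simp
qed simp

lemma N_triangle: "N (x + y) \<le> N x + N y"
proof -
  have "Re (ip x y) \<le> N x * N y"
    using Cauchy_Schwarz complex_Re_le_cmod order_trans by blast
  then have "(N (x + y))\<^sup>2 \<le> (N x + N y)\<^sup>2"
    by (simp add: N_add_sq power2_sum)
  then show ?thesis
    by (rule power2_le_imp_le) simp
qed

lemma N_triangle_diff: "N (x - y) \<le> N (x - w) + N (w - y)"
  using N_triangle [of "x - w" "w - y"] by simp

lemma N_diff_le: "N (x - y) \<le> N x + N y"
  using N_triangle [of x "- y"] by (simp add: N_minus)

lemma N_le_zero_eq: "N (x - y) \<le> 0 \<Longrightarrow> x = y"
  using N_eq_0 [of "x - y"] N_nonneg [of "x - y"] by simp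

section \<open>Norm convergence and dense sets\<close>

lemma hconv_dominated:
  assumes "eventually (\<lambda>t. N (f t - l) \<le> g t) F" and "(g \<longlongrightarrow> 0) F"
  shows "hconv ip f l F"
  unfolding hconv_def
  by (rule tendsto_sandwich [OF _ assms(1) tendsto_const assms(2)]) simp

lemma hconv_const [simp]: "hconv ip (\<lambda>_. x) x F"
  by (simp add: hconv_def)

lemma hconv_add:
  assumes "hconv ip f l F" and "hconv ip g m F"
  shows "hconv ip (\<lambda>t. f t + g t) (l + m) F"
proof (rule hconv_dominated)
  show "eventually (\<lambda>t. N (f t + g t - (l + m)) \<le> N (f t - l) + N (g t - m)) F"
    using N_triangle [of "f _ - l" "g _ - m"] by (simp add: algebra_simps)
  show "((\<lambda>t. N (f t - l) + N (g t - m)) \<longlongrightarrow> 0) F"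
    using tendsto_add [OF assms [unfolded hconv_def]] by simp
qed

lemma hconv_scl:
  assumes "hconv ip f l F" and "(c \<longlongrightarrow> d) F"
  shows "hconv ip (\<lambda>t. scl (c t) (f t)) (scl d l) F"
proof (rule hconv_dominated)
  have "N (scl (c t) (f t) - scl d l) \<le> cmod (c t) * N (f t - l) + cmod (c t - d) * N l" for t
    using N_triangle [of "scl (c t) (f t - l)" "scl (c t - d) l"]
    unfolding N_scl by (simp add: scale_right_diff_distrib scale_left_diff_distrib)
  then show "eventually (\<lambda>t. N (scl (c t) (f t) - scl d l)
      \<le> cmod (c t) * N (f t - l) + cmod (c t - d) * N l) F"
    by simp
  have "((\<lambda>t. cmod (c t) * N (f t - l) + cmod (c t - d) * N l) \<longlongrightarrow> cmod d * 0 + cmod (d - d) * N l) F"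
    using assms unfolding hconv_def by (intro tendsto_intros)
  then show "((\<lambda>t. cmod (c t) * N (f t - l) + cmod (c t - d) * N l) \<longlongrightarrow> 0) F"
    by simp
qed

lemma hconv_diff:
  assumes "hconv ip f l F" and "hconv ip g m F"
  shows "hconv ip (\<lambda>t. f t - g t) (l - m) F"
  using hconv_add [OF assms(1) hconv_scl [OF assms(2) tendsto_const [of "- 1"]]] by simp

lemma hconv_N:
  assumes "hconv ip f l F"
  shows "((\<lambda>t. N (f t)) \<longlongrightarrow> N l) F"
proof -
  have "((\<lambda>t. N (f t) - N l) \<longlongrightarrow> 0) F"
  proof (rule Lim_null_comparison)
    have "\<bar>N (f t) - N l\<bar> \<le> N (f t - l)" for t
      using N_triangle [of "f t - l" l] N_triangle [of "l - f t" "f t"] N_diff_commute [of l "f t"]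
      by simp
    then show "eventually (\<lambda>t. norm (N (f t) - N l) \<le> N (f t - l)) F" by simp
  qed (use assms hconv_def in blast)
  then show ?thesis by (simp add: Lim_null [symmetric])
qed

lemma hconv_ip:
  assumes "hconv ip f l F" and "hconv ip g m F"
  shows "((\<lambda>t. ip (f t) (g t)) \<longlongrightarrow> ip l m) F"
proof -
  have "((\<lambda>t. ip (f t) (g t) - ip l m) \<longlongrightarrow> 0) F"
  proof (rule Lim_null_comparison)
    have "cmod (ip (f t) (g t) - ip l m) \<le> N (f t - l) * N (g t) + N l * N (g t - m)" for t
    proof -
      have "ip (f t) (g t) - ip l m = ip (f t - l) (g t) + ip l (g t - m)"
        by (simp add: ip_simps)
      then show ?thesis
        using norm_triangle_ineq [of "ip (f t - l) (g t)" "ip l (g t - m)"]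
          Cauchy_Schwarz [of "f t - l" "g t"] Cauchy_Schwarz [of l "g t - m"] by simp
    qed
    then show "eventually (\<lambda>t. norm (ip (f t) (g t) - ip l m)
        \<le> N (f t - l) * N (g t) + N l * N (g t - m)) F"
      by simp
    have "((\<lambda>t. N (f t - l) * N (g t) + N l * N (g t - m)) \<longlongrightarrow> 0 * N m + N l * 0) F"
      using assms hconv_N [OF assms(2)] unfolding hconv_def by (intro tendsto_intros)
    then show "((\<lambda>t. N (f t - l) * N (g t) + N l * N (g t - m)) \<longlongrightarrow> 0) F"
      by simp
  qed
  then show ?thesis by (simp add: Lim_null [symmetric])
qed

lemma hconv_unique:
  assumes "F \<noteq> bot" and "hconv ip f l F" and "hconv ip f m F"
  shows "l = m"
proof -
  have "hconv ip (\<lambda>t. f t - f t) (l - m) F"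
    by (intro hconv_diff assms)
  then have "N (l - m) = 0"
    using assms(1) by (simp add: hconv_def tendsto_const_iff N_diff_commute [of l m])
  then show ?thesis by (simp add: N_eq_0)
qed

lemma hconv_cauchy:
  assumes "hconv ip X l sequentially"
  shows "hcauchy ip X"
  unfolding hcauchy_def
proof (intro allI impI)
  fix e :: real assume "e > 0"
  then have "eventually (\<lambda>n. N (X n - l) < e / 2) sequentially"
    using assms order_tendstoD(2) [of "\<lambda>n. N (X n - l)" 0 sequentially "e / 2"]
    by (simp add: hconv_def)
  then obtain K where K: "\<And>n. n \<ge> K \<Longrightarrow> N (X n - l) < e / 2"
    by (auto simp: eventually_sequentially)
  have "N (X m - X n) < e" if "m \<ge> K" "n \<ge> K" for m n
    using K [OF that(1)] K [OF that(2)] N_triangle_diff [of "X m" "X n" l]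
      N_diff_commute [of l "X n"] by linarith
  then show "\<exists>K. \<forall>m\<ge>K. \<forall>n\<ge>K. N (X m - X n) < e" by blast
qed

lemma hdense_sequence:
  assumes "hdense ip S"
  obtains X where "\<And>n. X n \<in> S" and "hconv ip X x sequentially"
proof -
  have "\<exists>s. s \<in> S \<and> N (x - s) < 1 / real (Suc n)" for n
    using assms unfolding hdense_def by (metis of_nat_0_less_iff zero_less_Suc zero_less_divide_1_iff)
  then obtain X where X: "\<And>n. X n \<in> S" "\<And>n. N (x - X n) < 1 / real (Suc n)"
    by metis
  have "hconv ip X x sequentially"
  proof (rule hconv_dominated)
    show "eventually (\<lambda>n. N (X n - x) \<le> 1 / real (Suc n)) sequentially"
      using X(2) N_diff_commute by (simp add: less_imp_le)
    show "(\<lambda>n. 1 / real (Suc n)) \<longlonglongrightarrow> 0"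
      using LIMSEQ_inverse_real_of_nat by (simp add: inverse_eq_divide)
  qed
  with X(1) that show thesis by blast
qed

text \<open>An e/3 argument: nonexpansiveness, uniform in \<open>t\<close>, carries convergence from
  a nearby point of \<open>S\<close> over to \<open>x\<close>. It serves both the resolvents and the
  limit group.\<close>

lemma hconv_from_dense:
  assumes "hdense ip S"
    and nonexp: "\<And>t x y. N (T t x - T t y) \<le> N (x - y)"
    and conv: "\<And>y. y \<in> S \<Longrightarrow> hconv ip (\<lambda>t. T t y) y F"
  shows "hconv ip (\<lambda>t. T t x) x F"
  unfolding hconv_def
proof (rule tendstoI)
  fix e :: real assume "e > 0"
  then obtain y where y: "y \<in> S" "N (x - y) < e / 3"
    using assms(1) unfolding hdense_def by (meson divide_pos_pos zero_less_numeral)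
  have "eventually (\<lambda>t. N (T t y - y) < e / 3) F"
    using conv [OF y(1)] \<open>e > 0\<close> order_tendstoD(2) [of "\<lambda>t. N (T t y - y)" 0 F "e / 3"]
    by (simp add: hconv_def)
  then show "eventually (\<lambda>t. dist (N (T t x - x)) 0 < e) F"
  proof eventually_elim
    case (elim t)
    have "N (T t x - x) < e"
      using elim y(2) nonexp [of t x y] N_triangle_diff [of "T t x" x "T t y"]
        N_triangle_diff [of "T t y" x y] N_diff_commute [of x y] by linarith
    then show ?case by simp
  qed
qed

section \<open>Orthogonal projection and iteration estimates\<close>

text \<open>Contains the projection theorem: the point of \<open>M\<close> nearest to \<open>x\<close> differs from \<open>x\<close> by a
  vector orthogonal to \<open>M\<close>.\<close>

lemma closed_subspace_eq_UNIV:
  assumes add: "\<And>x y. x \<in> M \<Longrightarrow> y \<in> M \<Longrightarrow> x + y \<in> M"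
    and scale: "\<And>a x. x \<in> M \<Longrightarrow> scl a x \<in> M"
    and zero: "0 \<in> M"
    and closed: "\<And>X l. (\<And>n. X n \<in> M) \<Longrightarrow> hconv ip X l sequentially \<Longrightarrow> l \<in> M"
    and perp: "\<And>y. (\<And>x. x \<in> M \<Longrightarrow> ip x y = 0) \<Longrightarrow> y = 0"
  shows "x \<in> M"
proof -
  define d where "d = (INF m\<in>M. (N (x - m))\<^sup>2)"
  have bdd: "bdd_below ((\<lambda>m. (N (x - m))\<^sup>2) ` M)"
    by (auto intro: bdd_belowI2 [of _ 0])
  have d_le: "d \<le> (N (x - m))\<^sup>2" if "m \<in> M" for m
    unfolding d_def using bdd that by (rule cINF_lower)
  have "\<exists>m. m \<in> M \<and> (N (x - m))\<^sup>2 < d + 1 / real (Suc n)" for n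
  proof -
    have "d < d + 1 / real (Suc n)" by simp
    then show ?thesis
      unfolding d_def using cINF_less_iff [OF _ bdd] zero by blast
  qed
  then obtain X where X: "\<And>n. X n \<in> M" "\<And>n. (N (x - X n))\<^sup>2 < d + 1 / real (Suc n)"
    by metis
  \<comment> \<open>The midpoint of \<open>X m\<close> and \<open>X n\<close> lies in
    \<open>M\<close>, so its squared distance to \<open>x\<close> is at least \<open>d\<close>; the
    parallelogram law then forces a minimizing sequence to be Cauchy.\<close>
  have gap: "(N (X m - X n))\<^sup>2 \<le> 2 / real (Suc m) + 2 / real (Suc n)" for m n
  proof -
    define h where "h = scl (1/2) (X m + X n)"
    have "h \<in> M" unfolding h_def using X(1) add scale by blast
    have "scl 2 (x - h) = (x - X m) + (x - X n)"
      using scale_left_distrib [of 1 1 x] by (simp add: h_def algebra_simps)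
    then have "(N ((x - X m) + (x - X n)))\<^sup>2 = 4 * (N (x - h))\<^sup>2"
      using N_scl [of 2 "x - h"] by (simp add: power_mult_distrib)
    with parallelogram [of "x - X m" "x - X n"] d_le [OF \<open>h \<in> M\<close>] X(2) [of m] X(2) [of n]
    have "(N (X n - X m))\<^sup>2 \<le> 2 / real (Suc m) + 2 / real (Suc n)"
      by simp
    then show ?thesis using N_diff_commute by metis
  qed
  have "hcauchy ip X"
    unfolding hcauchy_def
  proof (intro allI impI)
    fix e :: real assume "e > 0"
    \<comment> \<open>Beyond \<open>K\<close> the two terms of \<open>gap\<close> add up to at most
      \<open>4 / K\<close>, which is below the square of \<open>e\<close>.\<close>
    then obtain K where K: "K > 0" "1 / real K < e\<^sup>2 / 4"
      using real_arch_invD [of "e\<^sup>2 / 4"] by (auto simp: inverse_eq_divide)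
    have "N (X m - X n) < e" if "m \<ge> K" "n \<ge> K" for m n
    proof -
      have "1 / real (Suc m) \<le> 1 / real K" "1 / real (Suc n) \<le> 1 / real K"
        using that K(1) by (simp_all add: frac_le)
      then have "(N (X m - X n))\<^sup>2 < e\<^sup>2"
        using gap [of m n] K(2) by simp
      then show ?thesis using \<open>e > 0\<close> power2_less_imp_less by fastforce
    qed
    then show "\<exists>K. \<forall>m\<ge>K. \<forall>n\<ge>K. N (X m - X n) < e" by blast
  qed
  then obtain p where p: "hconv ip X p sequentially" using complete by blast
  have "p \<in> M" using closed X(1) p by blast
  have "(\<lambda>n. (N (x - X n))\<^sup>2) \<longlonglongrightarrow> (N (x - p))\<^sup>2"
    by (intro tendsto_power hconv_N hconv_diff hconv_const p)
  moreover have "(\<lambda>n. d + 1 / real (Suc n)) \<longlonglongrightarrow> d + 0"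
    using LIMSEQ_inverse_real_of_nat by (intro tendsto_add) (simp_all add: inverse_eq_divide)
  ultimately have le_d: "(N (x - p))\<^sup>2 \<le> d"
    using X(2) by (intro LIMSEQ_le) (auto intro: less_imp_le)
  have "ip m (x - p) = 0" if "m \<in> M" for m
  proof (rule ccontr)
    assume nz: "ip m (x - p) \<noteq> 0"
    then have "m \<noteq> 0" by auto
    then have Nm: "N m > 0" using N_eq_0 [of m] N_nonneg [of m] by linarith
    \<comment> \<open>If \<open>x - p\<close> were not orthogonal to \<open>m\<close>, adding to
      \<open>p\<close> the projection of \<open>x - p\<close> onto the line through \<open>m\<close>
      would give a point \<open>q\<close> of \<open>M\<close> strictly closer to
      \<open>x\<close>.\<close>
    define a where "a = ip (x - p) m / ip m m"
    define q where "q = p + scl a m"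
    have "q \<in> M" unfolding q_def using \<open>p \<in> M\<close> that add scale by blast
    have mm: "ip m m \<noteq> 0" using \<open>m \<noteq> 0\<close> ip_eq_0D by blast
    have "ip (x - q) (x - q) = ip (x - p - scl a m) (x - p - scl a m)"
      by (simp add: q_def algebra_simps)
    also have "\<dots> = ip (x - p) (x - p) - a * ip m (x - p)
        - cnj a * (ip (x - p) m - a * ip m m)"
      by (simp only: ip_diff_left [of "x - p" "scl a m"] ip_diff_right [of _ "x - p" "scl a m"]
          ip_scl_left ip_scl_right)
    also have "ip (x - p) m - a * ip m m = 0" using mm by (simp add: a_def)
    finally have "ip (x - q) (x - q) = ip (x - p) (x - p) - a * ip m (x - p)" by simp
    moreover have "a * ip m (x - p) = complex_of_real ((cmod (ip (x - p) m))\<^sup>2 / (N m)\<^sup>2)"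
      using ip_cnj [of m "x - p"]
      by (simp add: a_def ip_self [of m] complex_norm_square [symmetric])
    ultimately have "(N (x - q))\<^sup>2 = (N (x - p))\<^sup>2 - (cmod (ip (x - p) m))\<^sup>2 / (N m)\<^sup>2"
      by (simp add: N_sq del: of_real_power of_real_divide)
    moreover have "(cmod (ip (x - p) m))\<^sup>2 / (N m)\<^sup>2 > 0"
      using nz ip_cnj [of m "x - p"] Nm by simp
    ultimately show False using d_le [OF \<open>q \<in> M\<close>] le_d by linarith
  qed
  then have "x - p = 0" by (rule perp)
  with \<open>p \<in> M\<close> show ?thesis by simp
qed

text \<open>The factors \<open>T\<close> are exchanged for \<open>S\<close> one at a time. Each
  exchange costs at most \<open>e\<close> along the orbit of \<open>T\<close>, and the remaining
  factors \<open>S\<close> do not enlarge the error.\<close>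

lemma funpow_telescope:
  assumes nonexp: "\<And>x y. N (S x - S y) \<le> N (x - y)"
    and step: "\<And>j. N (S ((T ^^ j) x) - T ((T ^^ j) x)) \<le> e"
  shows "N ((S ^^ n) x - (T ^^ n) x) \<le> real n * e"
proof (induction n)
  case (Suc n)
  have "N ((S ^^ Suc n) x - (T ^^ Suc n) x)
      \<le> N (S ((S ^^ n) x) - S ((T ^^ n) x)) + N (S ((T ^^ n) x) - T ((T ^^ n) x))"
    using N_triangle_diff by simp
  also have "\<dots> \<le> N ((S ^^ n) x - (T ^^ n) x) + e"
    using nonexp step by (intro add_mono)
  finally show ?case using Suc by (simp add: algebra_simps)
qed simp

end

section \<open>Resolvents and Cayley transforms of skew-adjoint operators\<close>

locale skew_adjoint_operator = hilbert +
  fixes A :: "('a \<times> 'a) set"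
  assumes skew_adjoint: "skew_adjoint scl ip A"
begin

lemma A_zero: "(0, 0) \<in> A"
  and A_add: "(x, v) \<in> A \<Longrightarrow> (y, w) \<in> A \<Longrightarrow> (x + y, v + w) \<in> A"
  and A_scl: "(x, v) \<in> A \<Longrightarrow> (scl a x, scl a v) \<in> A"
  and A_zero_unique: "(0, y) \<in> A \<Longrightarrow> y = 0"
  and A_dense: "hdense ip (op_dom A)"
  and A_adjoint: "adjoint_graph ip A = {(x, - v) | x v. (x, v) \<in> A}"
  using skew_adjoint unfolding skew_adjoint_def lin_op_def by blast+

lemma A_diff: "(x, v) \<in> A \<Longrightarrow> (y, w) \<in> A \<Longrightarrow> (x - y, v - w) \<in> A"
  using A_add [of x v "- y" "- w"] A_scl [of y w "- 1"] by simp

lemma A_skew: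
  assumes "(x, v) \<in> A" and "(y, w) \<in> A"
  shows "ip v y = - ip x w"
proof -
  have "(y, - w) \<in> adjoint_graph ip A" using assms(2) A_adjoint by blast
  then show ?thesis using assms(1) by (simp add: adjoint_graph_def ip_minus_right)
qed

text \<open>This is the maximality contained in skew-adjointness: the adjoint is no larger than
  \<open>- A\<close>. Closedness, surjectivity of \<open>1 - h A\<close> and the identification of
  the generator all rest on it.\<close>

lemma A_memI:
  assumes "\<And>x v. (x, v) \<in> A \<Longrightarrow> ip v y = - ip x w"
  shows "(y, w) \<in> A"
proof -
  have "(y, - w) \<in> adjoint_graph ip A"
    using assms by (simp add: adjoint_graph_def ip_minus_right)
  then show ?thesis using A_adjoint by auto
qed

lemma A_closed:
  assumes "\<And>n. (X n, Y n) \<in> A" and "hconv ip X x sequentially" and "hconv ip Y y sequentially"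
  shows "(x, y) \<in> A"
proof (rule A_memI)
  fix p q assume pq: "(p, q) \<in> A"
  have "(\<lambda>n. ip q (X n)) \<longlonglongrightarrow> ip q x"
    by (intro hconv_ip hconv_const assms)
  moreover have "(\<lambda>n. ip q (X n)) \<longlonglongrightarrow> - ip p y"
    using A_skew [OF pq assms(1)] by (simp add: tendsto_minus hconv_ip assms)
  ultimately show "ip q x = - ip p y" by (rule LIMSEQ_unique)
qed

section \<open>Resolvents\<close>

lemma N_resolvent:
  assumes "(y, v) \<in> A"
  shows "(N (y - rscl h v))\<^sup>2 = (N y)\<^sup>2 + h\<^sup>2 * (N v)\<^sup>2"
proof -
  \<comment> \<open>Skewness makes \<open>ip y v\<close> purely imaginary, so the cross term in the
    squared norm vanishes.\<close>
  have "Re (ip y v) = 0"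
    using A_skew [OF assms assms] ip_cnj [of y v]
    by (metis cnj.sel(1) equal_neg_zero uminus_complex.sel(1))
  then show ?thesis
    using N_add_sq [of y "- rscl h v"] by (simp add: N_minus N_scl ip_simps power_mult_distrib)
qed

lemma resolvent_bound:
  assumes "(y, v) \<in> A"
  shows "N y \<le> N (y - rscl h v)" and "\<bar>h\<bar> * N v \<le> N (y - rscl h v)"
proof -
  have "(N y)\<^sup>2 \<le> (N (y - rscl h v))\<^sup>2"
    by (simp add: N_resolvent [OF assms])
  then show "N y \<le> N (y - rscl h v)" by (rule power2_le_imp_le) simp
  have "(\<bar>h\<bar> * N v)\<^sup>2 \<le> (N (y - rscl h v))\<^sup>2"
    by (simp add: N_resolvent [OF assms] power_mult_distrib)
  then show "\<bar>h\<bar> * N v \<le> N (y - rscl h v)" by (rule power2_le_imp_le) simp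
qed

text \<open>The range of \<open>1 - h A\<close> is a subspace. It is closed by the lower bounds in
  \<open>resolvent_bound\<close> and closedness of \<open>A\<close>, and its orthogonal complement
  is trivial, so it is everything.\<close>

lemma resolvent_exists:
  assumes "h \<noteq> 0"
  shows "\<exists>y v. (y, v) \<in> A \<and> y - rscl h v = x"
proof -
  define M where "M = {y - rscl h v | y v. (y, v) \<in> A}"
  have "x \<in> M"
  proof (rule closed_subspace_eq_UNIV)
    fix p q assume "p \<in> M" "q \<in> M"
    then obtain y v y' v' where *: "(y, v) \<in> A" "p = y - rscl h v" "(y', v') \<in> A" "q = y' - rscl h v'"
      unfolding M_def by blast
    have "p + q = (y + y') - rscl h (v + v')" unfolding *(2,4) by (simp add: algebra_simps)
    then show "p + q \<in> M" unfolding M_def using A_add [OF *(1,3)] by blast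
  next
    fix a p assume "p \<in> M"
    then obtain y v where *: "(y, v) \<in> A" "p = y - rscl h v" unfolding M_def by blast
    have "scl a p = scl a y - rscl h (scl a v)"
      using * by (simp add: scale_right_diff_distrib mult.commute)
    then show "scl a p \<in> M" unfolding M_def using A_scl [OF *(1)] by blast
  next
    have "0 = 0 - rscl h 0" by simp
    then show "0 \<in> M" unfolding M_def using A_zero by blast
  next
    fix X l assume X: "\<And>n. X n \<in> M" "hconv ip X l sequentially"
    then have "\<forall>n. \<exists>y v. (y, v) \<in> A \<and> X n = y - rscl h v" unfolding M_def by blast
    then obtain Y V where YV: "\<And>n. (Y n, V n) \<in> A" "\<And>n. X n = Y n - rscl h (V n)"
      by metis
    have eq: "X m - X n = (Y m - Y n) - rscl h (V m - V n)" for m n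
      by (simp add: YV(2) algebra_simps)
    \<comment> \<open>Both components of the preimages inherit the Cauchy property from
      \<open>X\<close>; the second one needs \<open>h\<close> nonzero.\<close>
    have bound: "N (Y m - Y n) \<le> N (X m - X n)" "\<bar>h\<bar> * N (V m - V n) \<le> N (X m - X n)" for m n
      unfolding eq by (intro resolvent_bound A_diff YV(1))+
    have X_cauchy: "hcauchy ip X" using X(2) by (rule hconv_cauchy)
    have "hcauchy ip Y"
      unfolding hcauchy_def using X_cauchy bound(1) unfolding hcauchy_def by (meson le_less_trans)
    moreover have "hcauchy ip V"
      unfolding hcauchy_def
    proof (intro allI impI)
      fix e :: real assume "e > 0"
      then have "\<bar>h\<bar> * e > 0" using assms by simp
      then obtain K where K: "\<And>m n. m \<ge> K \<Longrightarrow> n \<ge> K \<Longrightarrow> N (X m - X n) < \<bar>h\<bar> * e"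
        using X_cauchy unfolding hcauchy_def by blast
      have "N (V m - V n) < e" if "m \<ge> K" "n \<ge> K" for m n
      proof -
        have "\<bar>h\<bar> * N (V m - V n) < \<bar>h\<bar> * e"
          using le_less_trans [OF bound(2) K [OF that]] .
        then show ?thesis using assms by simp
      qed
      then show "\<exists>K. \<forall>m\<ge>K. \<forall>n\<ge>K. N (V m - V n) < e" by blast
    qed
    ultimately obtain y v where
      yv: "hconv ip Y y sequentially" "hconv ip V v sequentially"
      using complete by blast
    then have "(y, v) \<in> A" using A_closed YV(1) by blast
    have "hconv ip X (y - rscl h v) sequentially"
      unfolding YV(2) by (intro hconv_diff hconv_scl yv tendsto_const)
    then have "l = y - rscl h v" using X(2) hconv_unique sequentially_bot by blast
    with \<open>(y, v) \<in> A\<close> show "l \<in> M" unfolding M_def by blast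
  next
    fix u assume perp: "\<And>p. p \<in> M \<Longrightarrow> ip p u = 0"
    \<comment> \<open>A vector orthogonal to the range is an eigenvector of \<open>A\<close> for the
      real number \<open>- 1 / h\<close>, unless it is zero. Skew operators have no nonzero real
      eigenvalues.\<close>
    have "(u, rscl (- 1 / h) u) \<in> A"
    proof (rule A_memI)
      fix y v assume "(y, v) \<in> A"
      then have "ip (y - rscl h v) u = 0" using perp unfolding M_def by blast
      then show "ip v u = - ip y (rscl (- 1 / h) u)"
        using assms by (simp add: ip_simps field_simps)
    qed
    from A_skew [OF this this] have "ip u u = 0"
      using assms by (simp add: ip_simps)
    then show "u = 0" by (rule ip_eq_0D)
  qed
  then show ?thesis unfolding M_def by blast
qed

text \<open>The resolvent \<open>(1 - h A)\<^sup>-\<^sup>1\<close>; the case \<open>h = 0\<close> is separate because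
  \<open>1 - 0 A\<close> is only defined on the domain of \<open>A\<close>.\<close>

definition J :: "real \<Rightarrow> 'a \<Rightarrow> 'a" where
  "J h x = (if h = 0 then x else THE y. \<exists>v. (y, v) \<in> A \<and> y - rscl h v = x)"

lemma J_eq:
  assumes "(y, v) \<in> A"
  shows "J h (y - rscl h v) = y"
proof (cases "h = 0")
  case False
  have "y' = y" if "(y', v') \<in> A" "y' - rscl h v' = y - rscl h v" for y' v'
  proof -
    have "y' - y - rscl h (v' - v) = 0" using that(2) by (simp add: algebra_simps)
    then show ?thesis
      using resolvent_bound(1) [OF A_diff [OF that(1) assms], of h] N_le_zero_eq by simp
  qed
  then have "(THE y'. \<exists>v'. (y', v') \<in> A \<and> y' - rscl h v' = y - rscl h v) = y"
    using assms by (intro the_equality) blast+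
  then show ?thesis using False by (simp add: J_def)
qed (simp add: J_def)

lemma J_0 [simp]: "J 0 x = x"
  by (simp add: J_def)

lemma J_obtain:
  assumes "h \<noteq> 0"
  obtains v where "(J h x, v) \<in> A" and "x = J h x - rscl h v"
proof -
  obtain y v where "(y, v) \<in> A" "y - rscl h v = x"
    using resolvent_exists [OF assms] by blast
  with J_eq [of y v h] that show thesis by metis
qed

lemma J_add: "J h (x + y) = J h x + J h y"
proof (cases "h = 0")
  case False
  obtain v where v: "(J h x, v) \<in> A" "x = J h x - rscl h v" using J_obtain [OF False] .
  obtain w where w: "(J h y, w) \<in> A" "y = J h y - rscl h w" using J_obtain [OF False] .
  have "x + y = (J h x + J h y) - rscl h (v + w)"
    by (subst v(2), subst w(2)) (simp add: algebra_simps)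
  then show ?thesis using J_eq [OF A_add [OF v(1) w(1)], of h] by simp
qed simp

lemma J_scl: "J h (scl a x) = scl a (J h x)"
proof (cases "h = 0")
  case False
  obtain v where v: "(J h x, v) \<in> A" "x = J h x - rscl h v" using J_obtain [OF False] .
  have "scl a x = scl a (J h x) - rscl h (scl a v)"
    by (subst v(2)) (simp add: scale_right_diff_distrib mult.commute)
  then show ?thesis using J_eq [OF A_scl [OF v(1)], of h] by simp
qed simp

lemma J_minus: "J h (- x) = - J h x"
  using J_scl [of h "- 1" x] by simp

lemma J_diff: "J h (x - y) = J h x - J h y"
  using J_add [of h x "- y"] by (simp add: J_minus)

lemma N_J_le: "N (J h x) \<le> N x"
proof (cases "h = 0")
  case False
  obtain v where v: "(J h x, v) \<in> A" "x = J h x - rscl h v" using J_obtain [OF False] .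
  show ?thesis using resolvent_bound(1) [OF v(1), of h] v(2) by simp
qed simp

text \<open>\<open>A\<close> commutes with its resolvent, and \<open>J h = 1 + h J h A\<close> on
  the domain of \<open>A\<close>. The latter is the source of all expansions in the step size
  below.\<close>

lemma J_A_rscl:
  assumes "(x, v) \<in> A"
  shows "(J h x, J h v) \<in> A" and "J h x = x + rscl h (J h v)"
proof -
  have "(J h x, J h v) \<in> A \<and> J h x = x + rscl h (J h v)"
  proof (cases "h = 0")
    case False
    obtain p where p: "(J h x, p) \<in> A" "x = J h x - rscl h p" using J_obtain [OF False] .
    \<comment> \<open>Since \<open>p\<close> is \<open>(J h x - x) / h\<close>, linearity makes
      \<open>q\<close> the value of \<open>A\<close> at \<open>p\<close>; then
      \<open>p - h q = v\<close> exhibits \<open>p\<close> as \<open>J h v\<close>.\<close>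
    define q where "q = rscl (1 / h) (p - v)"
    have "rscl (1 / h) (J h x - x) = p"
      by (subst (2) p(2)) (use False in simp)
    then have "(p, q) \<in> A"
      unfolding q_def using A_scl [OF A_diff [OF p(1) assms]] by metis
    moreover have "p - rscl h q = v" using False by (simp add: q_def)
    ultimately have "J h v = p" using J_eq by blast
    moreover have "J h x = x + rscl h p" by (subst (2) p(2)) simp
    ultimately show ?thesis using p(1) by simp
  qed (use assms in simp)
  then show "(J h x, J h v) \<in> A" and "J h x = x + rscl h (J h v)" by blast+
qed

lemma J_range:
  assumes "h \<noteq> 0"
  shows "\<exists>w. (J h x, w) \<in> A"
  using J_obtain [OF assms] by metis

lemma J_commute: "J a (J b x) = J b (J a x)"
proof (cases "a = 0")
  case False
  obtain p where p: "(J a x, p) \<in> A" "x = J a x - rscl a p" using J_obtain [OF False] .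
  have "J b x = J b (J a x) - rscl a (J b p)"
    by (subst p(2)) (simp add: J_diff J_scl)
  then show ?thesis using J_eq [OF J_A_rscl(1) [OF p(1)], of a b] by simp
qed simp

section \<open>Strong convergence of resolvents and the domain of the square of
  \<open>A\<close>\<close>

lemma J_tendsto: "hconv ip (\<lambda>h. J h x) x (at 0)"
proof (rule hconv_from_dense [OF A_dense])
  show "N (J t x - J t y) \<le> N (x - y)" for t x y
    using N_J_le [of t "x - y"] by (simp add: J_diff)
next
  fix y assume "y \<in> op_dom A"
  then obtain v where v: "(y, v) \<in> A" by (auto simp: op_dom_def)
  show "hconv ip (\<lambda>h. J h y) y (at 0)"
  proof (rule hconv_dominated)
    have "N (J h y - y) \<le> \<bar>h\<bar> * N v" for h
      using J_A_rscl(2) [OF v, of h] N_J_le [of h v] by (simp add: N_scl mult_left_mono)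
    then show "eventually (\<lambda>h. N (J h y - y) \<le> \<bar>h\<bar> * N v) (at 0)" by simp
    have "((\<lambda>h. \<bar>h\<bar> * N v) \<longlongrightarrow> \<bar>0\<bar> * N v) (at 0)" by (intro tendsto_intros)
    then show "((\<lambda>h. \<bar>h\<bar> * N v) \<longlongrightarrow> 0) (at 0)" by simp
  qed
qed

text \<open>The domain of the square is a core: \<open>J h x\<close> and its image
  \<open>J h v\<close> approximate \<open>x\<close> and \<open>v\<close> simultaneously for small
  \<open>h\<close>, and for nonzero \<open>h\<close> the image is again in the domain of
  \<open>A\<close>. Control of both components is what \<open>U_derivative\<close> needs.\<close>

lemma A_square_core:
  assumes "(x, v) \<in> A" and "e > 0"
  obtains x' v' w where "(x', v') \<in> A" and "(v', w) \<in> A" and "N (x - x') < e" and "N (v - v') < e"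
proof -
  have ev: "eventually (\<lambda>h. N (J h u - u) < e) (at 0)" for u
    using order_tendstoD(2) [OF J_tendsto [unfolded hconv_def] assms(2)] .
  have "eventually (\<lambda>h. N (J h x - x) < e \<and> N (J h v - v) < e \<and> h \<noteq> 0) (at 0)"
    using ev by (intro eventually_conj) (auto simp: eventually_at_filter)
  then obtain h where h: "N (J h x - x) < e" "N (J h v - v) < e" "h \<noteq> 0"
    using eventually_happens by fastforce
  obtain w where "(J h v, w) \<in> A" using J_range [OF h(3)] by blast
  with J_A_rscl(1) [OF assms(1), of h] h(1,2) that N_diff_commute show thesis by metis
qed

lemma A_square_dense: "hdense ip (op_dom (A O A))"
  unfolding hdense_def
proof (intro allI impI)
  fix x and e :: real assume "e > 0"
  then obtain y where y: "y \<in> op_dom A" "N (x - y) < e / 2"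
    using A_dense unfolding hdense_def by (meson half_gt_zero)
  then obtain v where "(y, v) \<in> A" by (auto simp: op_dom_def)
  then obtain y' v' w where y': "(y', v') \<in> A" "(v', w) \<in> A" "N (y - y') < e / 2"
    using A_square_core [of y v "e / 2"] \<open>e > 0\<close> by (metis half_gt_zero)
  have "y' \<in> op_dom (A O A)" using y' by (force simp: op_dom_def)
  moreover have "N (x - y') < e" using y(2) y'(3) N_triangle_diff [of x y' y] by simp
  ultimately show "\<exists>s\<in>op_dom (A O A). N (x - s) < e" by blast
qed

section \<open>Cayley transforms and their semigroup defect\<close>

text \<open>The Cayley transform \<open>(1 + t/2 A) (1 - t/2 A)\<^sup>-\<^sup>1\<close>, which is unitary and
  agrees with \<open>exp (t A)\<close> to second order.\<close>

definition C :: "real \<Rightarrow> 'a \<Rightarrow> 'a" where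
  "C t x = J (t / 2) x + (J (t / 2) x - x)"

lemma C_0 [simp]: "C 0 = id"
  by (auto simp: C_def)

lemma C_add: "C t (x + y) = C t x + C t y"
  by (simp add: C_def J_add)

lemma C_scl: "C t (scl a x) = scl a (C t x)"
  by (simp add: C_def J_scl algebra_simps)

lemma C_diff: "C t (x - y) = C t x - C t y"
  by (simp add: C_def J_diff)

lemma C_A: "(x, v) \<in> A \<Longrightarrow> (C t x, C t v) \<in> A"
  unfolding C_def by (intro A_add A_diff J_A_rscl)

lemma C_commute: "C a \<circ> C b = C b \<circ> C a"
  by (rule ext) (simp add: C_def J_add J_diff J_commute [of "b / 2" "a / 2"])

lemma C_ip: "ip (C t x) (C t y) = ip x y"
proof (cases "t = 0")
  case False
  define h where "h = t / 2"
  have h: "h \<noteq> 0" using False by (simp add: h_def)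
  obtain v where v: "(J h x, v) \<in> A" "x = J h x - rscl h v" using J_obtain [OF h] .
  obtain w where w: "(J h y, w) \<in> A" "y = J h y - rscl h w" using J_obtain [OF h] .
  \<comment> \<open>With \<open>x\<close> written as \<open>(1 - h A)\<close> applied to
    \<open>J h x\<close>, the transform only flips the sign of \<open>h\<close>. In the inner
    product this affects just the mixed terms, whose sum is zero by skewness.\<close>
  have "C t x = J h x + rscl h v" using v(2) by (simp add: C_def h_def [symmetric] algebra_simps)
  moreover have "C t y = J h y + rscl h w"
    using w(2) by (simp add: C_def h_def [symmetric] algebra_simps)
  moreover have "ip (J h x + rscl h v) (J h y + rscl h w) = ip (J h x - rscl h v) (J h y - rscl h w)"
    using A_skew [OF v(1) w(1)] by (simp add: ip_simps algebra_simps)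
  ultimately show ?thesis using v(2) w(2) by simp
qed simp

lemma N_C: "N (C t x) = N x"
  by (simp add: hnorm_def C_ip)

lemma N_C_diff: "N (C t x - C t y) = N (x - y)"
  by (simp add: C_diff [symmetric] N_C)

text \<open>An exact difference quotient; as the resolvent is a contraction, the first and second
  order bounds follow from it at once.\<close>

lemma C_first_order:
  assumes "(x, v) \<in> A"
  shows "C t x - x = rscl t (J (t / 2) v)"
proof -
  have "C t x - x = rscl (t / 2) (J (t / 2) v) + rscl (t / 2) (J (t / 2) v)"
    by (simp add: C_def J_A_rscl(2) [OF assms])
  then show ?thesis by (simp add: scale_left_distrib [symmetric])
qed

lemma C_bound1:
  assumes "(x, v) \<in> A"
  shows "N (C t x - x) \<le> \<bar>t\<bar> * N v"
  by (simp add: C_first_order [OF assms] N_scl N_J_le mult_left_mono)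

lemma C_bound2:
  assumes "(x, v) \<in> A" and "(v, w) \<in> A"
  shows "N (C t x - x - rscl t v) \<le> t\<^sup>2 / 2 * N w"
proof -
  have "C t x - x - rscl t v = rscl (t\<^sup>2 / 2) (J (t / 2) w)"
    by (simp add: C_first_order [OF assms(1)] J_A_rscl(2) [OF assms(2)] scale_right_distrib
        power2_eq_square)
  then show ?thesis by (simp add: N_scl norm_divide norm_power N_J_le mult_left_mono)
qed

text \<open>Both maps send \<open>x\<close> to \<open>x + (a + b) v\<close> up to second order, so
  only quadratic remainders, measured by \<open>w\<close>, survive.\<close>

lemma C_semigroup_defect:
  assumes "(x, w) \<in> A O A"
  shows "N (C (a + b) x - C a (C b x)) \<le> (\<bar>a\<bar> + \<bar>b\<bar>)\<^sup>2 * N w"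
proof -
  obtain v where v: "(x, v) \<in> A" "(v, w) \<in> A" using assms by blast
  define r where "r t = C t x - x - rscl t v" for t
  have r: "N (r t) \<le> t\<^sup>2 / 2 * N w" for t
    unfolding r_def using C_bound2 [OF v] .
  have Cx: "C t x = x + rscl t v + r t" for t by (simp add: r_def)
  have "C a (C b x) = C a x + rscl b (C a v) + C a (r b)"
    by (subst Cx) (simp add: C_add C_scl)
  \<comment> \<open>The linear term of \<open>C b x\<close> is transported by \<open>C a\<close>;
    hence the extra contribution \<open>C a v - v\<close>, which is itself of order \<open>a\<close>
    because \<open>v\<close> lies in the domain of \<open>A\<close>.\<close>
  then have "C (a + b) x - C a (C b x) = (r (a + b) - r a) - (rscl b (C a v - v) + C a (r b))"
    by (simp add: Cx algebra_simps)
  then have "N (C (a + b) x - C a (C b x))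
      \<le> (N (r (a + b)) + N (r a)) + (N (rscl b (C a v - v)) + N (C a (r b)))"
    using N_diff_le [of "r (a + b) - r a" "rscl b (C a v - v) + C a (r b)"]
      N_diff_le [of "r (a + b)" "r a"] N_triangle [of "rscl b (C a v - v)" "C a (r b)"] by simp
  moreover have "N (rscl b (C a v - v)) \<le> \<bar>b\<bar> * (\<bar>a\<bar> * N w)"
    by (simp add: N_scl C_bound1 [OF v(2)] mult_left_mono)
  moreover have "N (C a (r b)) \<le> b\<^sup>2 / 2 * N w" using r by (simp add: N_C)
  ultimately have "N (C (a + b) x - C a (C b x))
      \<le> ((a + b)\<^sup>2 / 2 + a\<^sup>2 / 2 + \<bar>b\<bar> * \<bar>a\<bar> + b\<^sup>2 / 2) * N w"
    using r [of "a + b"] r [of a] by (simp add: algebra_simps)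
  also have "\<dots> \<le> (\<bar>a\<bar> + \<bar>b\<bar>)\<^sup>2 * N w"
  proof (rule mult_right_mono)
    have "a * b \<le> \<bar>a\<bar> * \<bar>b\<bar>" by (metis abs_ge_self abs_mult)
    then show "(a + b)\<^sup>2 / 2 + a\<^sup>2 / 2 + \<bar>b\<bar> * \<bar>a\<bar> + b\<^sup>2 / 2 \<le> (\<bar>a\<bar> + \<bar>b\<bar>)\<^sup>2"
      by (simp add: power2_sum field_simps)
  qed simp
  finally show ?thesis .
qed

text \<open>The one-step defect is quadratic in the step size, so \<open>n\<close> steps of size of
  order \<open>1 / n\<close> leave a total error of order \<open>1 / n\<close>.\<close>

lemma C_power_defect:
  assumes "(x, w) \<in> A O A"
  shows "N ((C (a + b) ^^ n) x - ((C a \<circ> C b) ^^ n) x) \<le> real n * ((\<bar>a\<bar> + \<bar>b\<bar>)\<^sup>2 * N w)"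
proof (rule funpow_telescope)
  show "N (C (a + b) x - C (a + b) y) \<le> N (x - y)" for x y by (simp add: N_C_diff)
next
  fix j
  \<comment> \<open>Cayley transforms preserve the graph of \<open>A\<close> and are isometric, so
    the whole orbit admits the same one-step error bound.\<close>
  have "(((C a \<circ> C b) ^^ j) x, ((C a \<circ> C b) ^^ j) w) \<in> A O A \<and> N (((C a \<circ> C b) ^^ j) w) = N w"
  proof (induction j)
    case (Suc j)
    then show ?case by (auto simp: N_C intro!: relcompI C_A)
  qed (use assms in simp)
  then show "N (C (a + b) (((C a \<circ> C b) ^^ j) x) - (C a \<circ> C b) (((C a \<circ> C b) ^^ j) x))
      \<le> (\<bar>a\<bar> + \<bar>b\<bar>)\<^sup>2 * N w"
    using C_semigroup_defect [of "((C a \<circ> C b) ^^ j) x" "((C a \<circ> C b) ^^ j) w" a b] by simp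
qed

section \<open>Stone's theorem\<close>

text \<open>Dyadic time steps suffice: halving the step is a case of \<open>C_power_defect\<close> with
  \<open>a = b\<close>, which makes the approximations Cauchy on the domain of \<open>A\<^sup>2\<close>.\<close>

definition E :: "nat \<Rightarrow> real \<Rightarrow> 'a \<Rightarrow> 'a" where
  "E k t = C (t / 2 ^ k) ^^ (2 ^ k)"

lemma E_ip: "ip (E k t x) (E k t y) = ip x y"
proof -
  have "ip ((C s ^^ n) x) ((C s ^^ n) y) = ip x y" for s n
    by (induction n) (simp_all add: C_ip)
  then show ?thesis by (simp add: E_def)
qed

lemma E_add: "E k t (x + y) = E k t x + E k t y"
proof -
  have "(C s ^^ n) (x + y) = (C s ^^ n) x + (C s ^^ n) y" for s n
    by (induction n) (simp_all add: C_add)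
  then show ?thesis by (simp add: E_def)
qed

lemma E_scl: "E k t (scl a x) = scl a (E k t x)"
proof -
  have "(C s ^^ n) (scl a x) = scl a ((C s ^^ n) x)" for s n
    by (induction n) (simp_all add: C_scl)
  then show ?thesis by (simp add: E_def)
qed

lemma N_E_diff: "N (E k t x - E k t y) = N (x - y)"
proof -
  have "E k t (x - y) = E k t x - E k t y"
    using E_add [of k t x "- y"] E_scl [of k t "- 1" y] by simp
  then show ?thesis by (metis E_ip hnorm_def)
qed

lemma E_Suc_diff:
  assumes "(x, w) \<in> A O A"
  shows "N (E k t x - E (Suc k) t x) \<le> t\<^sup>2 * N w / 2 ^ k"
proof -
  \<comment> \<open>\<open>h\<close> is the finer step: both approximations become iterates of
    length \<open>2 ^ k\<close>, one of \<open>C (h + h)\<close> and the other of \<open>C h\<close>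
    applied twice.\<close>
  define h where "h = t / 2 ^ Suc k"
  have "E (Suc k) t = (C h \<circ> C h) ^^ (2 ^ k)"
    using funpow_mult [where f = "C h" and m = 2 and n = "2 ^ k"] by (simp add: E_def h_def numeral_2_eq_2)
  moreover have "E k t = C (h + h) ^^ (2 ^ k)" by (simp add: E_def h_def)
  ultimately have "N (E k t x - E (Suc k) t x) \<le> real (2 ^ k) * ((\<bar>h\<bar> + \<bar>h\<bar>)\<^sup>2 * N w)"
    using C_power_defect [OF assms, where a = h and b = h and n = "2 ^ k"] by simp
  also have "(\<bar>h\<bar> + \<bar>h\<bar>)\<^sup>2 = t\<^sup>2 / (2 ^ k * 2 ^ k)"
    by (simp add: h_def power2_eq_square abs_mult [symmetric] field_simps)
  finally show ?thesis by simp
qed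

lemma E_diff:
  assumes "(x, w) \<in> A O A"
  shows "N (E k t x - E (k + j) t x) \<le> 2 * t\<^sup>2 * N w / 2 ^ k"
proof -
  \<comment> \<open>The right-hand side is the closed form of the finite geometric sum of the errors
    in \<open>E_Suc_diff\<close>; the subtracted tail lets the induction close.\<close>
  have "N (E k t x - E (k + j) t x) \<le> 2 * t\<^sup>2 * N w / 2 ^ k - 2 * t\<^sup>2 * N w / 2 ^ (k + j)"
  proof (induction j)
    case (Suc j)
    show ?case
      using Suc E_Suc_diff [OF assms, of "k + j" t]
        N_triangle_diff [of "E k t x" "E (k + Suc j) t x" "E (k + j) t x"] by simp
  qed simp
  then show ?thesis by (rule order_trans) simp
qed

text \<open>By \<open>E_diff\<close> the approximations are Cauchy on a dense set. Since they are
  isometries, four errors of size \<open>e / 4\<close> suffice at an arbitrary \<open>x\<close>,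
  passing through a nearby \<open>y\<close> and the index \<open>K\<close>.\<close>

lemma E_convergent: "\<exists>l. hconv ip (\<lambda>k. E k t x) l sequentially"
proof (rule complete, unfold hcauchy_def, intro allI impI)
  fix e :: real assume "e > 0"
  then obtain y where y: "y \<in> op_dom (A O A)" "N (x - y) < e / 4"
    using A_square_dense unfolding hdense_def by (meson divide_pos_pos zero_less_numeral)
  then obtain w where w: "(y, w) \<in> A O A" by (force simp: op_dom_def)
  have "eventually (\<lambda>k. 2 * t\<^sup>2 * N w / 2 ^ k < e / 4) sequentially"
    using order_tendstoD(2) [OF power_half_tendsto_0] \<open>e > 0\<close> by simp
  then obtain K where K: "2 * t\<^sup>2 * N w / 2 ^ K < e / 4"
    by (auto simp: eventually_sequentially)
  have near: "N (E K t y - E m t y) < e / 4" if "m \<ge> K" for m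
    using E_diff [OF w, of K t "m - K"] K that by simp
  have "N (E m t x - E n t x) < e" if "m \<ge> K" "n \<ge> K" for m n
    using near [OF that(1)] near [OF that(2)] y(2)
      N_triangle_diff [of "E m t x" "E n t x" "E m t y"]
      N_triangle_diff [of "E m t y" "E n t x" "E n t y"]
      N_triangle_diff [of "E m t y" "E n t y" "E K t y"]
      N_diff_commute [of "E m t y" "E K t y"] N_diff_commute [of y x]
      N_E_diff [of m t x y] N_E_diff [of n t y x] by linarith
  then show "\<exists>K. \<forall>m\<ge>K. \<forall>n\<ge>K. N (E m t x - E n t x) < e" by blast
qed

section \<open>The limit group\<close>

definition U :: "real \<Rightarrow> 'a \<Rightarrow> 'a" where
  "U t x = (SOME l. hconv ip (\<lambda>k. E k t x) l sequentially)"

lemma E_tendsto_U: "hconv ip (\<lambda>k. E k t x) (U t x) sequentially"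
  unfolding U_def using E_convergent by (rule someI_ex)

lemma U_eqI: "hconv ip (\<lambda>k. E k t x) l sequentially \<Longrightarrow> U t x = l"
  using hconv_unique E_tendsto_U sequentially_bot by blast

lemma U_0: "U 0 = id"
  by (rule ext, rule U_eqI) (simp add: E_def)

lemma U_add: "U t (x + y) = U t x + U t y"
  by (rule U_eqI) (simp add: E_add hconv_add E_tendsto_U)

lemma U_scl: "U t (scl a x) = scl a (U t x)"
  by (rule U_eqI) (simp add: E_scl hconv_scl E_tendsto_U)

lemma U_diff: "U t (x - y) = U t x - U t y"
  using U_add [of t x "- y"] U_scl [of t "- 1" y] by simp

lemma U_ip: "ip (U t x) (U t y) = ip x y"
proof -
  have "(\<lambda>k. ip (E k t x) (E k t y)) \<longlonglongrightarrow> ip (U t x) (U t y)"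
    by (intro hconv_ip E_tendsto_U)
  then show ?thesis by (simp add: E_ip LIMSEQ_const_iff)
qed

lemma N_U: "N (U t x) = N x"
  by (simp add: hnorm_def U_ip)

lemma N_U_diff: "N (U t x - U t y) = N (x - y)"
  by (simp add: U_diff [symmetric] N_U)

text \<open>Strong limits may be composed although both factors vary with \<open>k\<close>, because
  the outer factor is isometric.\<close>

lemma E_comp_tendsto: "hconv ip (\<lambda>k. E k s (E k t x)) (U s (U t x)) sequentially"
proof (rule hconv_dominated)
  have "N (E k s (E k t x) - U s (U t x)) \<le> N (E k t x - U t x) + N (E k s (U t x) - U s (U t x))" for k
    using N_triangle_diff [of "E k s (E k t x)" "U s (U t x)" "E k s (U t x)"] by (simp add: N_E_diff)
  then show "eventually (\<lambda>k. N (E k s (E k t x) - U s (U t x))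
      \<le> N (E k t x - U t x) + N (E k s (U t x) - U s (U t x))) sequentially"
    by simp
  show "(\<lambda>k. N (E k t x - U t x) + N (E k s (U t x) - U s (U t x))) \<longlonglongrightarrow> 0"
    using tendsto_add [OF E_tendsto_U [unfolded hconv_def] E_tendsto_U [unfolded hconv_def]] by simp
qed

lemma U_group_core:
  assumes "(x, w) \<in> A O A"
  shows "U (s + t) x = U s (U t x)"
proof -
  have "N (E k (s + t) x - E k s (E k t x)) \<le> (\<bar>s\<bar> + \<bar>t\<bar>)\<^sup>2 * N w / 2 ^ k" for k
  proof -
    define a b where "a = s / 2 ^ k" and "b = t / 2 ^ k"
    \<comment> \<open>Commuting Cayley transforms allow the two blocks of iterates to be
      interleaved, which puts the comparison into the form of \<open>C_power_defect\<close>.\<close>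
    have "E k s (E k t x) = ((C a \<circ> C b) ^^ (2 ^ k)) x"
      by (simp add: funpow_comp_commute [OF C_commute] E_def a_def b_def)
    moreover have "E k (s + t) = C (a + b) ^^ (2 ^ k)"
      by (simp add: E_def a_def b_def add_divide_distrib)
    ultimately have "N (E k (s + t) x - E k s (E k t x)) \<le> real (2 ^ k) * ((\<bar>a\<bar> + \<bar>b\<bar>)\<^sup>2 * N w)"
      using C_power_defect [OF assms, where a = a and b = b and n = "2 ^ k"] by simp
    also have "(\<bar>a\<bar> + \<bar>b\<bar>)\<^sup>2 = (\<bar>s\<bar> + \<bar>t\<bar>)\<^sup>2 / (2 ^ k * 2 ^ k)"
      by (simp add: a_def b_def power2_eq_square add_divide_distrib [symmetric])
    finally show ?thesis by simp
  qed
  then have "hconv ip (\<lambda>k. E k (s + t) x - E k s (E k t x)) 0 sequentially"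
    by (intro hconv_dominated [OF _ power_half_tendsto_0 [of "(\<bar>s\<bar> + \<bar>t\<bar>)\<^sup>2 * N w"]]) simp
  moreover have "hconv ip (\<lambda>k. E k (s + t) x - E k s (E k t x)) (U (s + t) x - U s (U t x)) sequentially"
    by (intro hconv_diff E_tendsto_U E_comp_tendsto)
  ultimately have "U (s + t) x - U s (U t x) = 0" using hconv_unique sequentially_bot by blast
  then show ?thesis by simp
qed

text \<open>Both sides are isometric in \<open>x\<close>, so the identity extends from the dense
  domain of the square of \<open>A\<close>.\<close>

lemma U_group: "U (s + t) = U s \<circ> U t"
proof (rule ext)
  fix x
  obtain X where X: "\<And>n. X n \<in> op_dom (A O A)" "hconv ip X x sequentially"
    using hdense_sequence [OF A_square_dense] by blast
  have eq: "U (s + t) (X n) = U s (U t (X n))" for n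
    using X(1) [of n] U_group_core by (force simp: op_dom_def)
  have cont: "hconv ip (\<lambda>n. U r (Y n)) (U r y) sequentially"
    if "hconv ip Y y sequentially" for r Y y
    using that by (simp add: hconv_def N_U_diff)
  have "hconv ip (\<lambda>n. U (s + t) (X n)) (U (s + t) x) sequentially"
    by (rule cont [OF X(2)])
  moreover have "hconv ip (\<lambda>n. U (s + t) (X n)) (U s (U t x)) sequentially"
    unfolding eq by (intro cont X(2))
  ultimately show "U (s + t) x = (U s \<circ> U t) x"
    using hconv_unique sequentially_bot by fastforce
qed

lemma U_inverse: "U t (U (- t) x) = x"
  using fun_cong [OF U_group [of t "- t"], of x] by (simp add: U_0)

lemma U_unitary: "unitary scl ip (U t)"
  unfolding unitary_def using U_add U_scl U_ip U_inverse by (metis surjI)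

section \<open>Derivative and generator of the limit group\<close>

lemma U_bound1:
  assumes "(x, v) \<in> A"
  shows "N (U t x - x) \<le> \<bar>t\<bar> * N v"
proof -
  have "N (E k t x - x) \<le> \<bar>t\<bar> * N v" for k
  proof -
    \<comment> \<open>Telescoping against the identity map, whose orbit stays at \<open>x\<close>:
      the number of steps cancels the step size, so the bound is uniform in
      \<open>k\<close>.\<close>
    have "N ((C (t / 2 ^ k) ^^ (2 ^ k)) x - (id ^^ (2 ^ k)) x) \<le> real (2 ^ k) * (\<bar>t / 2 ^ k\<bar> * N v)"
      by (rule funpow_telescope) (simp_all add: N_C_diff C_bound1 [OF assms] del: abs_divide)
    then show ?thesis by (simp add: E_def)
  qed
  moreover have "(\<lambda>k. N (E k t x - x)) \<longlonglongrightarrow> N (U t x - x)"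
    by (intro hconv_N hconv_diff hconv_const E_tendsto_U)
  ultimately show ?thesis by (intro Lim_bounded) auto
qed

lemma U_bound2:
  assumes "(x, v) \<in> A" and "(v, w) \<in> A"
  shows "N (U t x - x - rscl t v) \<le> 3 * t\<^sup>2 * N w"
proof -
  have xw: "(x, w) \<in> A O A" using assms by blast
  have "(\<lambda>k. N (C t x - E k t x)) \<longlonglongrightarrow> N (C t x - U t x)"
    by (intro hconv_N hconv_diff hconv_const E_tendsto_U)
  \<comment> \<open>\<open>C t\<close> is the approximation with \<open>k = 0\<close>. Its distance
    2 to the limit and the 1/2 from \<open>C_bound2\<close>, in units of
    \<open>t\<^sup>2 * N w\<close>, are rounded up to 3.\<close>
  moreover have "N (C t x - E k t x) \<le> 2 * t\<^sup>2 * N w" for k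
    using E_diff [OF xw, of 0 t k] by (simp add: E_def)
  ultimately have "N (C t x - U t x) \<le> 2 * t\<^sup>2 * N w"
    by (intro Lim_bounded) auto
  moreover have "N (U t x - x - rscl t v) \<le> N (U t x - C t x) + N (C t x - x - rscl t v)"
    using N_triangle [of "U t x - C t x" "C t x - x - rscl t v"] by (simp add: algebra_simps)
  moreover have "0 \<le> t\<^sup>2 * N w" by simp
  ultimately show ?thesis
    using C_bound2 [OF assms, of t] N_diff_commute [of "U t x" "C t x"] by linarith
qed

lemma U_strongly_continuous: "hconv ip (\<lambda>t. U t x) x (at 0)"
proof (rule hconv_from_dense [OF A_dense])
  show "N (U t x - U t y) \<le> N (x - y)" for t x y by (simp add: N_U_diff)
next
  fix y assume "y \<in> op_dom A"
  then obtain v where v: "(y, v) \<in> A" by (auto simp: op_dom_def)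
  show "hconv ip (\<lambda>t. U t y) y (at 0)"
  proof (rule hconv_dominated)
    show "eventually (\<lambda>t. N (U t y - y) \<le> \<bar>t\<bar> * N v) (at 0)"
      using U_bound1 [OF v] by simp
    have "((\<lambda>t. \<bar>t\<bar> * N v) \<longlongrightarrow> \<bar>0\<bar> * N v) (at 0)" by (intro tendsto_intros)
    then show "((\<lambda>t. \<bar>t\<bar> * N v) \<longlongrightarrow> 0) (at 0)" by simp
  qed
qed

text \<open>On the domain of the square, \<open>U_bound2\<close> gives the derivative directly. A
  general \<open>x\<close> is approximated in the graph norm, where \<open>U_bound1\<close> bounds
  the quotients of the difference uniformly in \<open>h\<close>.\<close>

lemma U_derivative:
  assumes "(x, v) \<in> A"
  shows "hconv ip (\<lambda>h. rscl (1 / h) (U h x - x)) v (at 0)"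
  unfolding hconv_def
proof (rule tendstoI)
  fix e :: real assume "e > 0"
  then obtain x' v' w where c: "(x', v') \<in> A" "(v', w) \<in> A" "N (v - v') < e / 3"
    using A_square_core [OF assms, of "e / 3"] by (metis divide_pos_pos zero_less_numeral)
  have "((\<lambda>h. 3 * \<bar>h\<bar> * N w) \<longlongrightarrow> 3 * \<bar>0\<bar> * N w) (at 0)" by (intro tendsto_intros)
  then have "eventually (\<lambda>h. 3 * \<bar>h\<bar> * N w < e / 3) (at 0)"
    using \<open>e > 0\<close> by (intro order_tendstoD(2)) auto
  moreover have "eventually (\<lambda>h. h \<noteq> 0) (at (0 :: real))"
    by (simp add: eventually_at_filter)
  ultimately show "eventually (\<lambda>h. dist (N (rscl (1 / h) (U h x - x) - v)) 0 < e) (at 0)"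
  proof eventually_elim
    case (elim h)
    define p where "p = rscl (1 / h) (U h (x - x') - (x - x'))"
    define q where "q = rscl (1 / h) (U h x' - x' - rscl h v')"
    have "rscl (1 / h) (U h x - x) - v = p + q + (v' - v)"
      using elim(2) by (simp add: p_def q_def U_diff algebra_simps)
    then have "N (rscl (1 / h) (U h x - x) - v) \<le> N p + N q + N (v - v')"
      using N_triangle [of "p + q" "v' - v"] N_triangle [of p q] N_diff_commute [of v v']
      by (simp only:)
    moreover have "N p \<le> N (v - v')"
      using U_bound1 [OF A_diff [OF assms c(1)], of h] elim(2)
      by (simp add: p_def N_scl norm_divide divide_simps mult.commute)
    moreover have "N q \<le> 3 * \<bar>h\<bar> * N w"
    proof -
      have "N q = N (U h x' - x' - rscl h v') / \<bar>h\<bar>"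
        unfolding q_def N_scl by (simp add: norm_divide)
      also have "\<dots> \<le> 3 * h\<^sup>2 * N w / \<bar>h\<bar>"
        using U_bound2 [OF c(1,2)] by (intro divide_right_mono) simp_all
      also have "\<dots> = 3 * \<bar>h\<bar> * N w"
        using elim(2) by (simp add: power2_eq_square abs_if)
      finally show ?thesis .
    qed
    ultimately have "N (rscl (1 / h) (U h x - x) - v) < e"
      using c(3) elim(1) by linarith
    then show ?case by simp
  qed
qed

text \<open>The inverse \<open>U (- h)\<close> is the adjoint of \<open>U h\<close>, so moving a
  difference quotient across the inner product reverses the sign of \<open>h\<close>.\<close>

lemma U_derivative_skew:
  assumes "hconv ip (\<lambda>h. rscl (1 / h) (U h x - x)) y (at 0)"
    and "hconv ip (\<lambda>h. rscl (1 / h) (U h p - p)) q (at 0)"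
  shows "ip q x = - ip p y"
proof -
  have minus: "filterlim (\<lambda>h :: real. - h) (at 0) (at 0)"
  proof (rule filterlim_atI)
    show "((\<lambda>h :: real. - h) \<longlongrightarrow> 0) (at 0)"
      using tendsto_minus [OF tendsto_ident_at [of "0 :: real"]] by simp
    show "eventually (\<lambda>h :: real. - h \<noteq> 0) (at 0)" by (simp add: eventually_at_filter)
  qed
  have "((\<lambda>h. ip p (rscl (1 / h) (U h x - x))) \<longlongrightarrow> ip p y) (at 0)"
    by (intro hconv_ip hconv_const assms)
  from tendsto_minus [OF filterlim_compose [OF this minus]]
  have "((\<lambda>h. - ip p (rscl (1 / - h) (U (- h) x - x))) \<longlongrightarrow> - ip p y) (at 0)" .
  moreover have "- ip p (rscl (1 / - h) (U (- h) x - x)) = ip (rscl (1 / h) (U h p - p)) x" for h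
  proof -
    have "ip p (U (- h) x) = ip (U h p) x"
      using U_ip [of h p "U (- h) x"] by (simp add: U_inverse)
    then show ?thesis by (simp add: ip_simps)
  qed
  ultimately have "((\<lambda>h. ip (rscl (1 / h) (U h p - p)) x) \<longlongrightarrow> - ip p y) (at 0)" by simp
  moreover have "((\<lambda>h. ip (rscl (1 / h) (U h p - p)) x) \<longlongrightarrow> ip q x) (at 0)"
    by (intro hconv_ip hconv_const assms)
  ultimately show ?thesis using tendsto_unique [OF trivial_limit_at] by blast
qed

lemma generator_U: "generator_graph scl ip U = A"
proof (intro set_eqI iffI)
  fix g assume "g \<in> generator_graph scl ip U"
  then obtain x y where g: "g = (x, y)" "hconv ip (\<lambda>h. rscl (1 / h) (U h x - x)) y (at 0)"
    unfolding generator_graph_def by blast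
  show "g \<in> A"
    unfolding g(1)
  \<comment> \<open>By \<open>U_derivative\<close> every pair in \<open>A\<close> is a derivative
    pair of \<open>U\<close>, so skewness of the derivative is exactly the membership test for
    \<open>A\<close>.\<close>
  proof (rule A_memI)
    fix p q assume "(p, q) \<in> A"
    then show "ip q x = - ip p y" using U_derivative_skew [OF g(2)] U_derivative by blast
  qed
next
  fix g assume "g \<in> A"
  then show "g \<in> generator_graph scl ip U"
    using U_derivative by (cases g) (simp add: generator_graph_def)
qed

theorem Stone: "generates_sc_unitary_group scl ip A"
  unfolding generates_sc_unitary_group_def
  using U_unitary U_0 U_group U_strongly_continuous generator_U by blast

end

section \<open>Compression by a rank-one projection\<close>

context hilbert
begin

text \<open>The first conclusion makes Stone's theorem applicable to \<open>Q L Q\<close>; the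
  second shows that taking the closure of \<open>Q L\<close> adds nothing.\<close>

lemma skew_adjoint_compression:
  assumes "skew_adjoint scl ip L" and "z \<in> op_dom L" and "z \<noteq> 0"
    and Q_def: "\<And>x. Q x = x - scl (ip x z / ip z z) z"
  shows "skew_adjoint scl ip {(x, Q v) | x v. (Q x, v) \<in> L}" (is "skew_adjoint scl ip ?A")
    and "graph_closure ip {(y, Q v) | y v. (y, v) \<in> L} = {(y, Q v) | y v. (y, v) \<in> L}"
proof -
  interpret L: skew_adjoint_operator scl ip L
    by unfold_locales (rule assms(1))
  obtain l where l: "(z, l) \<in> L" using assms(2) by (auto simp: op_dom_def)
  have zz: "ip z z \<noteq> 0" using assms(3) ip_eq_0D by blast
  have zz_real: "cnj (ip z z) = ip z z" by (simp add: ip_cnj [symmetric])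
  have Q_add: "Q (x + y) = Q x + Q y" for x y
    by (simp add: Q_def ip_add_left add_divide_distrib algebra_simps)
  have Q_scl: "Q (scl a x) = scl a (Q x)" for a x
    by (simp add: Q_def ip_scl_left algebra_simps)
  have Q_minus: "Q (- x) = - Q x" for x
    using Q_scl [of "- 1" x] by simp
  have Q_0: "Q 0 = 0" by (simp add: Q_def)
  have Q_z: "Q z = 0" using zz by (simp add: Q_def)
  have Q_sym: "ip (Q x) y = ip x (Q y)" for x y
    using ip_cnj [of z y] by (simp add: Q_def ip_simps zz_real)
  have Q_dom: "(Q x, v - scl (ip x z / ip z z) l) \<in> L" if "(x, v) \<in> L" for x v
    unfolding Q_def by (intro L.A_diff L.A_scl that l)
  have skew: "ip v y = - ip x w" if "(x, v) \<in> ?A" "(y, w) \<in> ?A" for x v y w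
  proof -
    obtain v' w' where *: "v = Q v'" "(Q x, v') \<in> L" "w = Q w'" "(Q y, w') \<in> L"
      using \<open>(x, v) \<in> ?A\<close> \<open>(y, w) \<in> ?A\<close> by blast
    have "ip v y = ip v' (Q y)" using *(1) by (simp add: Q_sym)
    also have "\<dots> = - ip (Q x) w'" using L.A_skew [OF *(2,4)] .
    also have "\<dots> = - ip x w" using *(3) by (simp add: Q_sym)
    finally show ?thesis .
  qed
  have "lin_op scl ?A"
    unfolding lin_op_def
  proof (intro conjI allI impI)
    show "(0, 0) \<in> ?A" using L.A_zero Q_0 by force
  next
    fix x v y w assume "(x, v) \<in> ?A" "(y, w) \<in> ?A"
    then obtain v' w' where *: "v = Q v'" "(Q x, v') \<in> L" "w = Q w'" "(Q y, w') \<in> L"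
      by blast
    have "(Q (x + y), v' + w') \<in> L" unfolding Q_add by (intro L.A_add *)
    moreover have "v + w = Q (v' + w')" by (simp add: * Q_add)
    ultimately show "(x + y, v + w) \<in> ?A" by blast
  next
    fix a x v assume "(x, v) \<in> ?A"
    then obtain v' where *: "v = Q v'" "(Q x, v') \<in> L" by blast
    have "(Q (scl a x), scl a v') \<in> L" unfolding Q_scl by (intro L.A_scl *)
    moreover have "scl a v = Q (scl a v')" by (simp add: * Q_scl)
    ultimately show "(scl a x, scl a v) \<in> ?A" by blast
  next
    fix y assume "(0, y) \<in> ?A"
    then obtain v where "y = Q v" "(Q 0, v) \<in> L" by blast
    then show "y = 0" using L.A_zero_unique Q_0 by metis
  qed
  moreover have "hdense ip (op_dom ?A)"
  proof -
    have "op_dom L \<subseteq> op_dom ?A"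
      using Q_dom by (force simp: op_dom_def)
    then show ?thesis using L.A_dense unfolding hdense_def by blast
  qed
  moreover have "adjoint_graph ip ?A = {(x, - v) | x v. (x, v) \<in> ?A}"
  proof (intro set_eqI iffI)
    fix g assume "g \<in> {(x, - v) | x v. (x, v) \<in> ?A}"
    then obtain y w where g: "g = (y, - w)" "(y, w) \<in> ?A" by blast
    then show "g \<in> adjoint_graph ip ?A"
      using skew [OF _ g(2)] unfolding adjoint_graph_def g(1) by (auto simp: ip_minus_right)
  next
    fix g assume "g \<in> adjoint_graph ip ?A"
    then obtain y w where g: "g = (y, w)" and adj: "\<And>x v. (x, v) \<in> ?A \<Longrightarrow> ip v y = ip x w"
      unfolding adjoint_graph_def by blast
    \<comment> \<open>The compression annihilates \<open>z\<close>, so every value of its adjoint is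
      orthogonal to \<open>z\<close> and hence fixed by \<open>Q\<close>.\<close>
    have "(z, 0) \<in> ?A" using Q_z Q_0 L.A_zero by force
    from adj [OF this] have "ip z w = 0" by simp
    then have Qw: "Q w = w" using ip_cnj [of w z] by (simp add: Q_def)
    \<comment> \<open>The only candidate for the value of \<open>L\<close> at \<open>Q y\<close>:
      its part orthogonal to \<open>z\<close> must be \<open>- w\<close>, and skewness against
      \<open>(z, l)\<close> determines its component along \<open>z\<close>.\<close>
    define u where "u = - w - scl (ip (Q y) l / ip z z) z"
    have "(Q y, u) \<in> L"
    proof (rule L.A_memI)
      fix x v assume xv: "(x, v) \<in> L"
      have "(x, Q (v - scl (ip x z / ip z z) l)) \<in> ?A" using Q_dom [OF xv] by blast
      from adj [OF this] have "ip (v - scl (ip x z / ip z z) l) (Q y) = ip x w"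
        by (simp only: Q_sym)
      then have "ip v (Q y) = ip x w + ip x z / ip z z * ip l (Q y)"
        by (simp add: ip_diff_left ip_scl_left diff_eq_eq)
      then show "ip v (Q y) = - ip x u"
        using ip_cnj [of l "Q y"] by (simp add: u_def ip_simps zz_real)
    qed
    moreover have "Q u = - w"
    proof -
      have "u = - w + scl (- (ip (Q y) l / ip z z)) z" by (simp add: u_def)
      then show ?thesis by (simp only: Q_add Q_scl Q_minus Q_z Qw) simp
    qed
    ultimately have "(y, - w) \<in> ?A" by force
    then show "g \<in> {(x, - v) | x v. (x, v) \<in> ?A}"
      unfolding g by (intro CollectI exI [of _ y] exI [of _ "- w"]) simp
  qed
  ultimately show "skew_adjoint scl ip ?A"
    unfolding skew_adjoint_def by blast
  show "graph_closure ip {(y, Q v) | y v. (y, v) \<in> L} = {(y, Q v) | y v. (y, v) \<in> L}"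
    (is "graph_closure ip ?B = ?B")
  proof (intro set_eqI iffI)
    fix g assume "g \<in> graph_closure ip ?B"
    then obtain x u X Y where g: "g = (x, u)" and XY: "\<And>n. (X n, Y n) \<in> ?B"
      and X: "hconv ip X x sequentially" and Y: "hconv ip Y u sequentially"
      unfolding graph_closure_def by blast
    from XY have "\<forall>n. \<exists>v. Y n = Q v \<and> (X n, v) \<in> L" by blast
    then obtain V where V: "\<And>n. Y n = Q (V n)" "\<And>n. (X n, V n) \<in> L" by metis
    \<comment> \<open>Skewness replaces \<open>ip v z\<close> by \<open>- ip y l\<close>, which is
      continuous in \<open>y\<close>. Thus the values of \<open>L\<close> can be recovered from
      convergent \<open>X\<close> and \<open>Y\<close>, and closedness of \<open>L\<close>
      applies.\<close>
    have QV: "Q v = v + scl (ip y l / ip z z) z" if "(y, v) \<in> L" for y v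
      by (simp add: Q_def L.A_skew [OF that l])
    have "V n = Y n - scl (ip (X n) l / ip z z) z" for n
      by (simp add: V(1) QV [OF V(2)])
    moreover have "hconv ip (\<lambda>n. Y n - scl (ip (X n) l / ip z z) z)
        (u - scl (ip x l / ip z z) z) sequentially"
      by (intro hconv_diff hconv_scl hconv_const Y tendsto_divide hconv_ip X tendsto_const zz)
    ultimately have "hconv ip V (u - scl (ip x l / ip z z) z) sequentially" by presburger
    then have xv: "(x, u - scl (ip x l / ip z z) z) \<in> L" using L.A_closed [OF V(2) X] by blast
    have "u = Q (u - scl (ip x l / ip z z) z)" by (simp add: QV [OF xv])
    with xv show "g \<in> ?B" unfolding g by blast
  next
    fix g assume g: "g \<in> ?B"
    have "\<exists>X Y. (\<forall>n. (X n, Y n) \<in> ?B) \<and> hconv ip X (fst g) sequentially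
        \<and> hconv ip Y (snd g) sequentially"
      by (rule exI [of _ "\<lambda>_. fst g"], rule exI [of _ "\<lambda>_. snd g"])
        (intro conjI allI hconv_const, unfold prod.collapse, rule g)
    then show "g \<in> graph_closure ip ?B"
      unfolding graph_closure_def by (simp only: mem_Collect_eq case_prod_beta)
  qed
qed

end

theorem theorem5:
  fixes scl :: "complex \<Rightarrow> 'a::ab_group_add \<Rightarrow> 'a"
    and ip :: "'a \<Rightarrow> 'a \<Rightarrow> complex"
    and L :: "('a \<times> 'a) set"
    and z :: 'a
  assumes "complex_hilbert_space scl ip"
    and "skew_adjoint scl ip L"
    and "z \<in> op_dom L"
    and "z \<noteq> 0"
  defines "Q \<equiv> \<lambda>x. x - scl (ip x z / ip z z) z"
  shows "generates_sc_unitary_group scl ip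
           {(x, w). (Q x, w) \<in> graph_closure ip {(y, Q v) | y v. (y, v) \<in> L}}"
proof -
  interpret hilbert scl ip by unfold_locales (rule assms(1))
  have "Q x = x - scl (ip x z / ip z z) z" for x by (simp add: Q_def)
  note compression = skew_adjoint_compression [OF assms(2-4) this]
  interpret compressed: skew_adjoint_operator scl ip "{(x, Q v) | x v. (Q x, v) \<in> L}"
    by unfold_locales (rule compression(1))
  \<comment> \<open>Once the closure is removed, precomposition with \<open>Q\<close> on its natural
    domain gives the compressed operator.\<close>
  have "{(x, w). (Q x, w) \<in> graph_closure ip {(y, Q v) | y v. (y, v) \<in> L}}
      = {(x, Q v) | x v. (Q x, v) \<in> L}"
    unfolding compression(2) by blast
  then show ?thesis using compressed.Stone by simp
qed

end
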